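(* The class of $\mathsf{GL}_2$-chains does not have the amalgamation property.
   Context: An $\mathsf{FL}_{ew}$-algebra is a commutative integral residuated lattice with an extra constant $0$ as bottom. $\mathsf{GL}_2$ is the variety of $\mathsf{FL}_{ew}$-algebras generated by the totally ordered $\mathsf{FL}_{ew}$-algebras satisfying $x^2=x^3$ and, for all $x,y$, $x=1$ or $x(x\wedge y)\le(x\wedge y)^2$; $\mathsf{GL}_2$-chains are its totally ordered members. A class has the amalgamation property if for all $\mathbf A,\mathbf B,\mathbf C$ in it and embeddings $i:\mathbf A\to\mathbf B$, $j:\mathbf A\to\mathbf C$ there exist $\mathbf D$ in the class and embeddings $h:\mathbf B\to\mathbf D$, $k:\mathbf C\to\mathbf D$ with $h\circ i=k\circ j$. *)

theory Defs
  imports "HOL-Algebra.Group" "HOL-Library.Countable_Set" "HOL-Library.Infinite_Typeclass"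
begin

record 'a flew = "'a monoid" +
  fmeet :: "'a \<Rightarrow> 'a \<Rightarrow> 'a" (infixl "\<^bold>\<and>\<index>" 70)
  fjoin :: "'a \<Rightarrow> 'a \<Rightarrow> 'a" (infixl "\<^bold>\<or>\<index>" 65)
  fimp :: "'a \<Rightarrow> 'a \<Rightarrow> 'a" (infixr "\<^bold>\<rightarrow>\<index>" 60)
  fbot :: 'a ("\<^bold>0\<index>")

definition fle :: "('a, 'm) flew_scheme \<Rightarrow> 'a \<Rightarrow> 'a \<Rightarrow> bool" (infix "\<^bold>\<le>\<index>" 50)
  where "x \<^bold>\<le>\<^bsub>L\<^esub> y \<longleftrightarrow> x \<^bold>\<and>\<^bsub>L\<^esub> y = x"

locale flew_algebra = comm_monoid L for L :: "'a flew" (structure) +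
  assumes meet_closed: "\<lbrakk>x \<in> carrier L; y \<in> carrier L\<rbrakk> \<Longrightarrow> x \<^bold>\<and> y \<in> carrier L"
    and join_closed: "\<lbrakk>x \<in> carrier L; y \<in> carrier L\<rbrakk> \<Longrightarrow> x \<^bold>\<or> y \<in> carrier L"
    and imp_closed: "\<lbrakk>x \<in> carrier L; y \<in> carrier L\<rbrakk> \<Longrightarrow> x \<^bold>\<rightarrow> y \<in> carrier L"
    and bot_closed: "\<^bold>0 \<in> carrier L"
    and meet_comm: "\<lbrakk>x \<in> carrier L; y \<in> carrier L\<rbrakk> \<Longrightarrow> x \<^bold>\<and> y = y \<^bold>\<and> x"
    and join_comm: "\<lbrakk>x \<in> carrier L; y \<in> carrier L\<rbrakk> \<Longrightarrow> x \<^bold>\<or> y = y \<^bold>\<or> x"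
    and meet_assoc: "\<lbrakk>x \<in> carrier L; y \<in> carrier L; z \<in> carrier L\<rbrakk>
      \<Longrightarrow> (x \<^bold>\<and> y) \<^bold>\<and> z = x \<^bold>\<and> (y \<^bold>\<and> z)"
    and join_assoc: "\<lbrakk>x \<in> carrier L; y \<in> carrier L; z \<in> carrier L\<rbrakk>
      \<Longrightarrow> (x \<^bold>\<or> y) \<^bold>\<or> z = x \<^bold>\<or> (y \<^bold>\<or> z)"
    and meet_absorb: "\<lbrakk>x \<in> carrier L; y \<in> carrier L\<rbrakk> \<Longrightarrow> x \<^bold>\<and> (x \<^bold>\<or> y) = x"
    and join_absorb: "\<lbrakk>x \<in> carrier L; y \<in> carrier L\<rbrakk> \<Longrightarrow> x \<^bold>\<or> (x \<^bold>\<and> y) = x"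
    and residuation: "\<lbrakk>x \<in> carrier L; y \<in> carrier L; z \<in> carrier L\<rbrakk>
      \<Longrightarrow> x \<otimes> z \<^bold>\<le> y \<longleftrightarrow> z \<^bold>\<le> x \<^bold>\<rightarrow> y"
    and integral: "x \<in> carrier L \<Longrightarrow> x \<^bold>\<le> \<one>"
    and bot_least: "x \<in> carrier L \<Longrightarrow> \<^bold>0 \<^bold>\<le> x"

definition totally_ordered :: "'a flew \<Rightarrow> bool"
  where "totally_ordered L \<longleftrightarrow>
    (\<forall>x\<in>carrier L. \<forall>y\<in>carrier L. x \<^bold>\<le>\<^bsub>L\<^esub> y \<or> y \<^bold>\<le>\<^bsub>L\<^esub> x)"

definition flew_hom :: "'a flew \<Rightarrow> 'b flew \<Rightarrow> ('a \<Rightarrow> 'b) \<Rightarrow> bool"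
  where "flew_hom L M h \<longleftrightarrow>
    h \<in> carrier L \<rightarrow> carrier M \<and>
    h \<one>\<^bsub>L\<^esub> = \<one>\<^bsub>M\<^esub> \<and>
    h \<^bold>0\<^bsub>L\<^esub> = \<^bold>0\<^bsub>M\<^esub> \<and>
    (\<forall>x\<in>carrier L. \<forall>y\<in>carrier L.
      h (x \<otimes>\<^bsub>L\<^esub> y) = h x \<otimes>\<^bsub>M\<^esub> h y \<and>
      h (x \<^bold>\<and>\<^bsub>L\<^esub> y) = h x \<^bold>\<and>\<^bsub>M\<^esub> h y \<and>
      h (x \<^bold>\<or>\<^bsub>L\<^esub> y) = h x \<^bold>\<or>\<^bsub>M\<^esub> h y \<and>
      h (x \<^bold>\<rightarrow>\<^bsub>L\<^esub> y) = h x \<^bold>\<rightarrow>\<^bsub>M\<^esub> h y)"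

definition flew_embedding :: "'a flew \<Rightarrow> 'b flew \<Rightarrow> ('a \<Rightarrow> 'b) \<Rightarrow> bool"
  where "flew_embedding L M h \<longleftrightarrow> flew_hom L M h \<and> inj_on h (carrier L)"

datatype flew_term =
    Var nat
  | One
  | Bot
  | Mult flew_term flew_term
  | Meet flew_term flew_term
  | Join flew_term flew_term
  | Imp flew_term flew_term

instance flew_term :: countable
  by countable_datatype

primrec term_value :: "'a flew \<Rightarrow> (nat \<Rightarrow> 'a) \<Rightarrow> flew_term \<Rightarrow> 'a" where
  "term_value L v (Var n) = v n"
| "term_value L v One = \<one>\<^bsub>L\<^esub>"
| "term_value L v Bot = \<^bold>0\<^bsub>L\<^esub>"
| "term_value L v (Mult s t) = term_value L v s \<otimes>\<^bsub>L\<^esub> term_value L v t"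
| "term_value L v (Meet s t) = term_value L v s \<^bold>\<and>\<^bsub>L\<^esub> term_value L v t"
| "term_value L v (Join s t) = term_value L v s \<^bold>\<or>\<^bsub>L\<^esub> term_value L v t"
| "term_value L v (Imp s t) = term_value L v s \<^bold>\<rightarrow>\<^bsub>L\<^esub> term_value L v t"

definition satisfies_eq :: "'a flew \<Rightarrow> flew_term \<Rightarrow> flew_term \<Rightarrow> bool"
  where "satisfies_eq L s t \<longleftrightarrow>
    (\<forall>v. range v \<subseteq> carrier L \<longrightarrow> term_value L v s = term_value L v t)"

text \<open>
  The variety generated by a class \<open>K\<close> of FL_ew-algebras is the class of models of the
  equational theory of \<open>K\<close>. The generating algebras and the members of the variety may
  live on different types.
\<close>

definition generated_variety :: "'g flew set \<Rightarrow> 'a flew set"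
  where "generated_variety K =
    {L. flew_algebra L \<and>
        (\<forall>s t. (\<forall>G\<in>K. satisfies_eq G s t) \<longrightarrow> satisfies_eq L s t)}"

definition GL2_generators :: "'a flew set"
  where "GL2_generators =
    {L. flew_algebra L \<and> totally_ordered L \<and>
        (\<forall>x\<in>carrier L. x [^]\<^bsub>L\<^esub> (2::nat) = x [^]\<^bsub>L\<^esub> (3::nat)) \<and>
        (\<forall>x\<in>carrier L. \<forall>y\<in>carrier L.
           x = \<one>\<^bsub>L\<^esub> \<or> x \<otimes>\<^bsub>L\<^esub> (x \<^bold>\<and>\<^bsub>L\<^esub> y) \<^bold>\<le>\<^bsub>L\<^esub> (x \<^bold>\<and>\<^bsub>L\<^esub> y) [^]\<^bsub>L\<^esub> (2::nat))}"

text \<open>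
  A definition cannot quantify over all types, so the equational theory is read off the
  generators with carrier in \<^typ>\<open>nat\<close>. Nothing is lost: by the theorem
  \<open>GL2_equational_theory\<close> below, every equation valid in these is valid in the
  generators on any other type.
\<close>

definition GL2 :: "'a flew set"
  where "GL2 = generated_variety (GL2_generators :: nat flew set)"

definition GL2_chains :: "'a flew set"
  where "GL2_chains = {L \<in> GL2. totally_ordered L}"

text \<open>
  \<open>K\<close> and \<open>K'\<close> are meant to be the same class, the first restricted to algebras on the
  type \<^typ>\<open>'a\<close> and the second to algebras on the type \<^typ>\<open>'d\<close>; separating the
  types lets the amalgam be larger than the given algebras. For a failure of amalgamation
  the type \<^typ>\<open>'d\<close> has to be arbitrary, while \<^typ>\<open>'a\<close> only has to be large
  enough to carry the given algebras.
\<close>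

definition amalgamation_property :: "'a flew set \<Rightarrow> 'd flew set \<Rightarrow> bool"
  where "amalgamation_property K K' \<longleftrightarrow>
    (\<forall>A\<in>K. \<forall>B\<in>K. \<forall>C\<in>K. \<forall>i j.
       flew_embedding A B i \<longrightarrow> flew_embedding A C j \<longrightarrow>
       (\<exists>D\<in>K'. \<exists>h k. flew_embedding B D h \<and> flew_embedding C D k \<and>
          (\<forall>x\<in>carrier A. h (i x) = k (j x))))"

lemma flew_algebra_pow:
  assumes "flew_algebra L" "x \<in> carrier L"
  shows "x [^]\<^bsub>L\<^esub> (2::nat) = x \<otimes>\<^bsub>L\<^esub> x" "x [^]\<^bsub>L\<^esub> (3::nat) = x \<otimes>\<^bsub>L\<^esub> x \<otimes>\<^bsub>L\<^esub> x"
proof -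
  interpret flew_algebra L by fact
  show "x [^]\<^bsub>L\<^esub> (2::nat) = x \<otimes>\<^bsub>L\<^esub> x" "x [^]\<^bsub>L\<^esub> (3::nat) = x \<otimes>\<^bsub>L\<^esub> x \<otimes>\<^bsub>L\<^esub> x"
    using assms(2) by (simp_all add: numeral_eq_Suc)
qed

lemma flew_algebra_embedded:
  fixes L :: "'a flew" and M :: "'b flew"
  assumes M: "flew_algebra M" and h: "flew_embedding L M h"
    and cons: "\<one>\<^bsub>L\<^esub> \<in> carrier L" "\<^bold>0\<^bsub>L\<^esub> \<in> carrier L"
    and ops: "\<And>x y. \<lbrakk>x \<in> carrier L; y \<in> carrier L\<rbrakk> \<Longrightarrow>
      x \<otimes>\<^bsub>L\<^esub> y \<in> carrier L \<and> x \<^bold>\<and>\<^bsub>L\<^esub> y \<in> carrier L \<and>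
      x \<^bold>\<or>\<^bsub>L\<^esub> y \<in> carrier L \<and> x \<^bold>\<rightarrow>\<^bsub>L\<^esub> y \<in> carrier L"
  shows "flew_algebra L"
proof -
  interpret M: flew_algebra M by fact
  have eq: "x = y \<longleftrightarrow> h x = h y" if "x \<in> carrier L" "y \<in> carrier L" for x y
    using h that by (auto simp: flew_embedding_def inj_on_def)
  have hc: "h x \<in> carrier M" if "x \<in> carrier L" for x
    using h that by (auto simp: flew_embedding_def flew_hom_def)
  have hh: "h \<one>\<^bsub>L\<^esub> = \<one>\<^bsub>M\<^esub>" "h \<^bold>0\<^bsub>L\<^esub> = \<^bold>0\<^bsub>M\<^esub>"
    "\<And>x y. \<lbrakk>x \<in> carrier L; y \<in> carrier L\<rbrakk> \<Longrightarrow> h (x \<otimes>\<^bsub>L\<^esub> y) = h x \<otimes>\<^bsub>M\<^esub> h y"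
    "\<And>x y. \<lbrakk>x \<in> carrier L; y \<in> carrier L\<rbrakk> \<Longrightarrow> h (x \<^bold>\<and>\<^bsub>L\<^esub> y) = h x \<^bold>\<and>\<^bsub>M\<^esub> h y"
    "\<And>x y. \<lbrakk>x \<in> carrier L; y \<in> carrier L\<rbrakk> \<Longrightarrow> h (x \<^bold>\<or>\<^bsub>L\<^esub> y) = h x \<^bold>\<or>\<^bsub>M\<^esub> h y"
    "\<And>x y. \<lbrakk>x \<in> carrier L; y \<in> carrier L\<rbrakk> \<Longrightarrow> h (x \<^bold>\<rightarrow>\<^bsub>L\<^esub> y) = h x \<^bold>\<rightarrow>\<^bsub>M\<^esub> h y"
    using h by (auto simp: flew_embedding_def flew_hom_def)
  have le: "x \<^bold>\<le>\<^bsub>L\<^esub> y \<longleftrightarrow> h x \<^bold>\<le>\<^bsub>M\<^esub> h y" if "x \<in> carrier L" "y \<in> carrier L" for x y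
    using that ops by (simp add: fle_def eq hh)
  show ?thesis
  proof unfold_locales
    show "x \<otimes>\<^bsub>L\<^esub> y \<otimes>\<^bsub>L\<^esub> z = x \<otimes>\<^bsub>L\<^esub> (y \<otimes>\<^bsub>L\<^esub> z)"
      if "x \<in> carrier L" "y \<in> carrier L" "z \<in> carrier L" for x y z
      using that ops by (simp add: eq hh hc M.m_assoc)
    show "\<one>\<^bsub>L\<^esub> \<otimes>\<^bsub>L\<^esub> x = x" "x \<otimes>\<^bsub>L\<^esub> \<one>\<^bsub>L\<^esub> = x" if "x \<in> carrier L" for x
      using that ops cons by (simp_all add: eq hh hc)
    show "x \<otimes>\<^bsub>L\<^esub> y = y \<otimes>\<^bsub>L\<^esub> x" if "x \<in> carrier L" "y \<in> carrier L" for x y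
      using that ops by (simp add: eq hh hc M.m_comm)
    show "x \<^bold>\<and>\<^bsub>L\<^esub> y = y \<^bold>\<and>\<^bsub>L\<^esub> x" if "x \<in> carrier L" "y \<in> carrier L" for x y
      using that ops by (simp add: eq hh hc M.meet_comm)
    show "x \<^bold>\<or>\<^bsub>L\<^esub> y = y \<^bold>\<or>\<^bsub>L\<^esub> x" if "x \<in> carrier L" "y \<in> carrier L" for x y
      using that ops by (simp add: eq hh hc M.join_comm)
    show "x \<^bold>\<and>\<^bsub>L\<^esub> y \<^bold>\<and>\<^bsub>L\<^esub> z = x \<^bold>\<and>\<^bsub>L\<^esub> (y \<^bold>\<and>\<^bsub>L\<^esub> z)"
      if "x \<in> carrier L" "y \<in> carrier L" "z \<in> carrier L" for x y z
      using that ops by (simp add: eq hh hc M.meet_assoc)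
    show "x \<^bold>\<or>\<^bsub>L\<^esub> y \<^bold>\<or>\<^bsub>L\<^esub> z = x \<^bold>\<or>\<^bsub>L\<^esub> (y \<^bold>\<or>\<^bsub>L\<^esub> z)"
      if "x \<in> carrier L" "y \<in> carrier L" "z \<in> carrier L" for x y z
      using that ops by (simp add: eq hh hc M.join_assoc)
    show "x \<^bold>\<and>\<^bsub>L\<^esub> (x \<^bold>\<or>\<^bsub>L\<^esub> y) = x" if "x \<in> carrier L" "y \<in> carrier L" for x y
      using that ops by (simp add: eq hh hc M.meet_absorb)
    show "x \<^bold>\<or>\<^bsub>L\<^esub> (x \<^bold>\<and>\<^bsub>L\<^esub> y) = x" if "x \<in> carrier L" "y \<in> carrier L" for x y
      using that ops by (simp add: eq hh hc M.join_absorb)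
    show "x \<otimes>\<^bsub>L\<^esub> z \<^bold>\<le>\<^bsub>L\<^esub> y \<longleftrightarrow> z \<^bold>\<le>\<^bsub>L\<^esub> x \<^bold>\<rightarrow>\<^bsub>L\<^esub> y"
      if "x \<in> carrier L" "y \<in> carrier L" "z \<in> carrier L" for x y z
      using that ops by (simp add: le hh hc M.residuation)
    show "x \<^bold>\<le>\<^bsub>L\<^esub> \<one>\<^bsub>L\<^esub>" "\<^bold>0\<^bsub>L\<^esub> \<^bold>\<le>\<^bsub>L\<^esub> x" if "x \<in> carrier L" for x
      using that cons by (simp_all add: le hh hc M.integral M.bot_least)
  qed (use cons ops in auto)
qed

lemma GL2_generators_embedded:
  fixes L :: "'a flew" and M :: "'b flew"
  assumes M: "M \<in> GL2_generators" and L: "flew_algebra L" and h: "flew_embedding L M h"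
  shows "L \<in> GL2_generators"
proof -
  have M': "flew_algebra M" "totally_ordered M"
    using M by (auto simp: GL2_generators_def)
  interpret L: flew_algebra L by fact
  interpret M: flew_algebra M by (fact M'(1))
  have eq: "x = y \<longleftrightarrow> h x = h y" if "x \<in> carrier L" "y \<in> carrier L" for x y
    using h that by (auto simp: flew_embedding_def inj_on_def)
  have hc: "h x \<in> carrier M" if "x \<in> carrier L" for x
    using h that by (auto simp: flew_embedding_def flew_hom_def)
  have hh: "h \<one>\<^bsub>L\<^esub> = \<one>\<^bsub>M\<^esub>"
    "\<And>x y. \<lbrakk>x \<in> carrier L; y \<in> carrier L\<rbrakk> \<Longrightarrow> h (x \<otimes>\<^bsub>L\<^esub> y) = h x \<otimes>\<^bsub>M\<^esub> h y"
    "\<And>x y. \<lbrakk>x \<in> carrier L; y \<in> carrier L\<rbrakk> \<Longrightarrow> h (x \<^bold>\<and>\<^bsub>L\<^esub> y) = h x \<^bold>\<and>\<^bsub>M\<^esub> h y"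
    using h by (auto simp: flew_embedding_def flew_hom_def)
  have le: "x \<^bold>\<le>\<^bsub>L\<^esub> y \<longleftrightarrow> h x \<^bold>\<le>\<^bsub>M\<^esub> h y" if "x \<in> carrier L" "y \<in> carrier L" for x y
    using that by (simp add: fle_def eq hh L.meet_closed)
  have M_pow: "x \<otimes>\<^bsub>M\<^esub> x = x \<otimes>\<^bsub>M\<^esub> x \<otimes>\<^bsub>M\<^esub> x" if "x \<in> carrier M" for x
    using M that by (auto simp: GL2_generators_def flew_algebra_pow[OF M'(1)])
  have M_alt: "x = \<one>\<^bsub>M\<^esub> \<or> x \<otimes>\<^bsub>M\<^esub> (x \<^bold>\<and>\<^bsub>M\<^esub> y) \<^bold>\<le>\<^bsub>M\<^esub> (x \<^bold>\<and>\<^bsub>M\<^esub> y) \<otimes>\<^bsub>M\<^esub> (x \<^bold>\<and>\<^bsub>M\<^esub> y)"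
    if "x \<in> carrier M" "y \<in> carrier M" for x y
    using M that unfolding flew_algebra_pow(1)[OF M'(1) M.meet_closed[OF that], symmetric]
    by (auto simp: GL2_generators_def)
  have "totally_ordered L"
    using M'(2) by (simp add: totally_ordered_def le hc)
  moreover have "x [^]\<^bsub>L\<^esub> (2::nat) = x [^]\<^bsub>L\<^esub> (3::nat)" if x: "x \<in> carrier L" for x
  proof -
    have "h (x \<otimes>\<^bsub>L\<^esub> x) = h (x \<otimes>\<^bsub>L\<^esub> x \<otimes>\<^bsub>L\<^esub> x)"
      using M_pow[OF hc[OF x]] x by (simp add: hh)
    then show ?thesis
      using x by (simp add: flew_algebra_pow[OF L] eq)
  qed
  moreover have "x = \<one>\<^bsub>L\<^esub> \<or> x \<otimes>\<^bsub>L\<^esub> (x \<^bold>\<and>\<^bsub>L\<^esub> y) \<^bold>\<le>\<^bsub>L\<^esub> (x \<^bold>\<and>\<^bsub>L\<^esub> y) [^]\<^bsub>L\<^esub> (2::nat)"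
    if xy: "x \<in> carrier L" "y \<in> carrier L" for x y
    using M_alt[OF hc[OF xy(1)] hc[OF xy(2)]] xy
    by (simp add: flew_algebra_pow[OF L] L.meet_closed le eq hh)
  ultimately show ?thesis
    using L by (auto simp: GL2_generators_def)
qed

lemma term_value_closed:
  assumes "flew_algebra L" "range v \<subseteq> carrier L"
  shows "term_value L v t \<in> carrier L"
proof -
  interpret flew_algebra L by fact
  show ?thesis
    using assms(2)
    by (induction t) (auto simp: meet_closed join_closed imp_closed bot_closed)
qed

theorem GL2_equational_theory:
  "(\<forall>G\<in>(GL2_generators :: nat flew set). satisfies_eq G s t) \<Longrightarrow>
   (\<forall>G\<in>(GL2_generators :: 'a flew set). satisfies_eq G s t)"
proof
  fix G :: "'a flew"
  assume nat: "\<forall>G\<in>(GL2_generators :: nat flew set). satisfies_eq G s t"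
    and G: "G \<in> GL2_generators"
  have flew: "flew_algebra G"
    using G by (simp add: GL2_generators_def)
  show "satisfies_eq G s t"
    unfolding satisfies_eq_def
  proof (intro allI impI)
    fix v :: "nat \<Rightarrow> 'a"
    assume v: "range v \<subseteq> carrier G"
    define S where "S = range (term_value G v)"
    have S: "S \<subseteq> carrier G"
      using term_value_closed[OF flew v] by (auto simp: S_def)
    define f where "f = to_nat_on S"
    define g where "g = inv_into S f"
    have inj: "inj_on f S"
      unfolding f_def by (rule inj_on_to_nat_on) (simp add: S_def)
    have gf: "g (f x) = x" if "x \<in> S" for x
      using that inj by (simp add: g_def)
    have SI: "term_value G v r \<in> S" for r
      by (simp add: S_def)
    have cl: "\<one>\<^bsub>G\<^esub> \<in> S" "\<^bold>0\<^bsub>G\<^esub> \<in> S"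
      using SI[of One] SI[of Bot] by simp_all
    have cl2: "x \<otimes>\<^bsub>G\<^esub> y \<in> S \<and> x \<^bold>\<and>\<^bsub>G\<^esub> y \<in> S \<and> x \<^bold>\<or>\<^bsub>G\<^esub> y \<in> S \<and> x \<^bold>\<rightarrow>\<^bsub>G\<^esub> y \<in> S"
      if "x \<in> S" "y \<in> S" for x y
    proof -
      obtain p q where "x = term_value G v p" "y = term_value G v q"
        using \<open>x \<in> S\<close> \<open>y \<in> S\<close> by (auto simp: S_def)
      then show ?thesis
        using SI[of "Mult p q"] SI[of "Meet p q"] SI[of "Join p q"] SI[of "Imp p q"] by simp
    qed
    define H :: "nat flew" where "H =
      \<lparr>carrier = f ` S, mult = (\<lambda>x y. f (g x \<otimes>\<^bsub>G\<^esub> g y)), one = f \<one>\<^bsub>G\<^esub>,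
       fmeet = (\<lambda>x y. f (g x \<^bold>\<and>\<^bsub>G\<^esub> g y)), fjoin = (\<lambda>x y. f (g x \<^bold>\<or>\<^bsub>G\<^esub> g y)),
       fimp = (\<lambda>x y. f (g x \<^bold>\<rightarrow>\<^bsub>G\<^esub> g y)), fbot = f \<^bold>0\<^bsub>G\<^esub>\<rparr>"
    have emb: "flew_embedding H G g"
      unfolding flew_embedding_def flew_hom_def
      using S cl cl2 by (auto simp: H_def gf inj_on_def)
    have "flew_algebra H"
      by (rule flew_algebra_embedded[OF flew emb]) (use cl cl2 in \<open>auto simp: H_def gf\<close>)
    then have H: "H \<in> GL2_generators"
      by (rule GL2_generators_embedded[OF G _ emb])
    have val: "term_value H (f \<circ> v) r = f (term_value G v r)" for r
      by (induction r) (auto simp: H_def gf SI)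
    have "range (f \<circ> v) \<subseteq> carrier H"
      using SI[of "Var _"] by (auto simp: H_def)
    then have "f (term_value G v s) = f (term_value G v t)"
      using nat H unfolding satisfies_eq_def val[symmetric] by blast
    then show "term_value G v s = term_value G v t"
      using inj SI by (auto dest: inj_onD)
  qed
qed

end

theory Submission
  imports Defs
begin

text \<open>
  In a chain satisfying the defining condition, \<open>z \<otimes> b = b \<otimes> b\<close> whenever \<open>b \<le> z < 1\<close>. Hence
  if \<open>b\<close> is not idempotent, then \<open>b \<rightarrow> b \<otimes> b\<close> is the coatom of the chain, and it remains the
  coatom in every extension. Let \<open>A\<close> be the three-element Goedel chain \<open>0 < a < 1\<close>. Extend it to
  \<open>B\<close>, the chain \<open>0 < d < b < a < 1\<close> with \<open>b \<otimes> b = d\<close> and the other elements idempotent, and to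
  \<open>C\<close>, the Goedel chain \<open>0 < a < c < 1\<close>. An amalgam would contain \<open>c\<close> strictly between the coatom
  \<open>a = b \<rightarrow> d\<close> and \<open>1\<close>. The element \<open>d\<close> is needed because \<open>b \<otimes> b = 0\<close> would give
  \<open>a \<rightarrow> 0 = b\<close>, so that \<open>A\<close> would not be a subalgebra of \<open>B\<close>.
\<close>

text \<open>The concrete chains live on \<open>nat\<close>, while the theorem speaks of an arbitrary
  infinite type; an injection \<open>f\<close> carries the chains over. On the range of
  \<open>f\<close>, \<open>g\<close> is its inverse.\<close>

definition transport_flew :: "('a \<Rightarrow> 'b) \<Rightarrow> 'a flew \<Rightarrow> 'b flew"
  where "transport_flew f L =
    (let g = inv_into UNIV f in
     \<lparr>carrier = f ` carrier L, mult = (\<lambda>x y. f (g x \<otimes>\<^bsub>L\<^esub> g y)), one = f \<one>\<^bsub>L\<^esub>,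
      fmeet = (\<lambda>x y. f (g x \<^bold>\<and>\<^bsub>L\<^esub> g y)), fjoin = (\<lambda>x y. f (g x \<^bold>\<or>\<^bsub>L\<^esub> g y)),
      fimp = (\<lambda>x y. f (g x \<^bold>\<rightarrow>\<^bsub>L\<^esub> g y)), fbot = f \<^bold>0\<^bsub>L\<^esub>\<rparr>)"

text \<open>The inverse of \<open>f\<close> embeds the copy back into \<open>L\<close>, and an
  algebra that embeds into a generator is again a generator.\<close>

lemma transport_flew_generators:
  assumes "inj f" and L: "L \<in> GL2_generators"
  shows "transport_flew f L \<in> GL2_generators"
proof -
  have flew: "flew_algebra L"
    using L by (simp add: GL2_generators_def)
  interpret flew_algebra L by fact
  have emb: "flew_embedding (transport_flew f L) L (inv_into UNIV f)"
    using \<open>inj f\<close>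
    by (auto simp: flew_embedding_def flew_hom_def transport_flew_def Let_def inj_on_def)
  have "flew_algebra (transport_flew f L)"
    by (rule flew_algebra_embedded[OF flew emb])
      (use \<open>inj f\<close> in \<open>auto simp: transport_flew_def Let_def
        meet_closed join_closed imp_closed bot_closed\<close>)
  then show ?thesis
    by (rule GL2_generators_embedded[OF L _ emb])
qed

lemma transport_flew_embedding:
  assumes "inj f" and e: "flew_embedding L M e"
  shows "flew_embedding (transport_flew f L) (transport_flew f M) (f \<circ> e \<circ> inv_into UNIV f)"
proof -
  have "inj_on (f \<circ> e \<circ> inv_into UNIV f) (f ` carrier L)"
    using e \<open>inj f\<close> by (auto simp: flew_embedding_def inj_on_def)
  then show ?thesis
    using e \<open>inj f\<close> by (auto simp: flew_embedding_def flew_hom_def transport_flew_def Let_def)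
qed

text \<open>The variety is read off the generators on \<open>nat\<close>;
  \<open>GL2_equational_theory\<close> carries each of its equations over to the generators on any
  type.\<close>

lemma GL2_generators_subset_chains: "GL2_generators \<subseteq> GL2_chains"
proof
  fix L :: "'a flew"
  assume L: "L \<in> GL2_generators"
  then have "flew_algebra L" "totally_ordered L"
    by (auto simp: GL2_generators_def)
  moreover have "satisfies_eq L s t"
    if "\<forall>G\<in>(GL2_generators :: nat flew set). satisfies_eq G s t" for s t
    using GL2_equational_theory[OF that] L by blast
  ultimately show "L \<in> GL2_chains"
    by (auto simp: GL2_chains_def GL2_def generated_variety_def)
qed

context flew_algebra
begin

lemma fle_antisym: "\<lbrakk>x \<in> carrier L; y \<in> carrier L; x \<^bold>\<le> y; y \<^bold>\<le> x\<rbrakk> \<Longrightarrow> x = y"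
  by (metis fle_def meet_comm)

lemma fle_trans:
  "\<lbrakk>x \<in> carrier L; y \<in> carrier L; z \<in> carrier L; x \<^bold>\<le> y; y \<^bold>\<le> z\<rbrakk> \<Longrightarrow> x \<^bold>\<le> z"
  by (metis fle_def meet_assoc)

lemma join_eq_right: "\<lbrakk>x \<in> carrier L; y \<in> carrier L; x \<^bold>\<le> y\<rbrakk> \<Longrightarrow> x \<^bold>\<or> y = y"
  by (metis fle_def join_absorb join_comm meet_comm)

text \<open>Residuation at \<open>z = \<one>\<close>, together with \<open>\<one>\<close> being the
  top. This turns inequalities into equations.\<close>

lemma imp_eq_one_iff:
  assumes "x \<in> carrier L" "y \<in> carrier L"
  shows "x \<^bold>\<rightarrow> y = \<one> \<longleftrightarrow> x \<^bold>\<le> y"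
  using residuation[OF assms one_closed] assms
  by (metis fle_antisym imp_closed integral one_closed r_one)

lemma join_one: "x \<in> carrier L \<Longrightarrow> \<one> \<^bold>\<or> x = \<one>"
  by (metis integral join_comm join_eq_right one_closed)

end

text \<open>
  In a chain the disjunction \<open>x = 1 \<or> u \<le> v\<close> is the equation \<open>x \<or> (u \<rightarrow> v) = 1\<close>, so it passes
  from the generators to all chains of the variety.
\<close>

lemma GL2_chains_mult_le:
  assumes D: "D \<in> GL2_chains" and x: "x \<in> carrier D" "x \<noteq> \<one>\<^bsub>D\<^esub>"
    and y: "y \<in> carrier D" and le: "y \<^bold>\<le>\<^bsub>D\<^esub> x"
  shows "x \<otimes>\<^bsub>D\<^esub> y \<^bold>\<le>\<^bsub>D\<^esub> y \<otimes>\<^bsub>D\<^esub> y"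
proof -
  define m where "m = Meet (Var 0) (Var 1)"
  define t where "t = Join (Var 0) (Imp (Mult (Var 0) m) (Mult m m))"
  have flew: "flew_algebra D" and tot: "totally_ordered D"
    using D by (auto simp: GL2_chains_def GL2_def generated_variety_def)
  interpret flew_algebra D by fact
  have "satisfies_eq G t One" if G: "G \<in> GL2_generators" for G :: "nat flew"
    unfolding satisfies_eq_def
  proof (intro allI impI)
    fix v :: "nat \<Rightarrow> nat"
    assume v: "range v \<subseteq> carrier G"
    have G': "flew_algebra G"
      using G by (simp add: GL2_generators_def)
    interpret G: flew_algebra G by fact
    have v': "v n \<in> carrier G" for n
      using v by auto
    define w where "w = v 0 \<^bold>\<and>\<^bsub>G\<^esub> v 1"
    have w: "w \<in> carrier G"
      using v' by (simp add: w_def G.meet_closed)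
    have "v 0 = \<one>\<^bsub>G\<^esub> \<or> v 0 \<otimes>\<^bsub>G\<^esub> w \<^bold>\<le>\<^bsub>G\<^esub> w [^]\<^bsub>G\<^esub> (2::nat)"
      using G v' by (auto simp: GL2_generators_def w_def)
    then have "v 0 = \<one>\<^bsub>G\<^esub> \<or> (v 0 \<otimes>\<^bsub>G\<^esub> w) \<^bold>\<rightarrow>\<^bsub>G\<^esub> (w \<otimes>\<^bsub>G\<^esub> w) = \<one>\<^bsub>G\<^esub>"
      using v' w by (simp add: flew_algebra_pow[OF G'] G.imp_eq_one_iff)
    then have "v 0 \<^bold>\<or>\<^bsub>G\<^esub> ((v 0 \<otimes>\<^bsub>G\<^esub> w) \<^bold>\<rightarrow>\<^bsub>G\<^esub> (w \<otimes>\<^bsub>G\<^esub> w)) = \<one>\<^bsub>G\<^esub>"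
      using v' w by (auto simp: G.join_one G.imp_closed G.join_eq_right G.integral)
    then show "term_value G v t = term_value G v One"
      by (simp add: t_def m_def w_def)
  qed
  then have "satisfies_eq D t One"
    using D by (auto simp: GL2_chains_def GL2_def generated_variety_def)
  \<comment> \<open>Under \<open>v\<close> the term \<open>m\<close> takes the value
    \<open>y\<close>, because \<open>y \<le> x\<close>.\<close>
  moreover define v where "v n = (if n = 0 then x else y)" for n :: nat
  moreover have "range v \<subseteq> carrier D"
    using x y by (auto simp: v_def)
  moreover have "x \<^bold>\<and>\<^bsub>D\<^esub> y = y"
    using le x y by (simp add: fle_def meet_comm)
  ultimately have *: "x \<^bold>\<or>\<^bsub>D\<^esub> ((x \<otimes>\<^bsub>D\<^esub> y) \<^bold>\<rightarrow>\<^bsub>D\<^esub> (y \<otimes>\<^bsub>D\<^esub> y)) = \<one>\<^bsub>D\<^esub>"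
    by (auto simp: satisfies_eq_def t_def m_def dest!: spec[of _ v])
  define e where "e = (x \<otimes>\<^bsub>D\<^esub> y) \<^bold>\<rightarrow>\<^bsub>D\<^esub> (y \<otimes>\<^bsub>D\<^esub> y)"
  have e: "e \<in> carrier D"
    using x y by (simp add: e_def imp_closed)
  \<comment> \<open>In a chain a join is one of its two arguments. Since \<open>x\<close> is not
    \<open>\<one>\<close>, \<open>*\<close> forces \<open>e = \<one>\<close>.\<close>
  have "x \<^bold>\<le>\<^bsub>D\<^esub> e \<or> e \<^bold>\<le>\<^bsub>D\<^esub> x"
    using tot x e by (simp add: totally_ordered_def)
  then have "e = \<one>\<^bsub>D\<^esub>"
    using * x e join_eq_right join_comm unfolding e_def[symmetric] by metis
  then show ?thesis
    using x y by (simp add: e_def imp_eq_one_iff)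
qed

text \<open>
  The numbers \<open>0, 1, 2, 3, 4, 5\<close> stand for \<open>0, d, b, a, c, 1\<close>. The operations are residuated on
  the three carriers used below, but not on the whole of \<open>{0..5}\<close>.
\<close>

definition span_chain :: "nat set \<Rightarrow> nat flew"
  where "span_chain S =
    \<lparr>carrier = S,
     mult = (\<lambda>x y. if x = 5 then y else if y = 5 then x
       else if min x y = 2 then 1 else min x y),
     one = 5, fmeet = min, fjoin = max,
     fimp = (\<lambda>x y. if x \<le> y then 5 else if x = 2 \<and> y = 1 then 3
       else if x = 3 \<and> y = 1 then 2 else y),
     fbot = 0\<rparr>"

lemma fle_span_chain: "x \<^bold>\<le>\<^bsub>span_chain S\<^esub> y \<longleftrightarrow> x \<le> y"
  by (auto simp: fle_def span_chain_def min_def)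

lemma span_chain_generators:
  assumes "S \<in> {{0,3,5}, {0,1,2,3,5}, {0,3,4,5}}"
  shows "span_chain S \<in> GL2_generators"
proof -
  let ?L = "span_chain S"
  have ops: "\<forall>x\<in>S. \<forall>y\<in>S. x \<otimes>\<^bsub>?L\<^esub> y \<in> S \<and> x \<^bold>\<rightarrow>\<^bsub>?L\<^esub> y \<in> S \<and> x \<otimes>\<^bsub>?L\<^esub> y = y \<otimes>\<^bsub>?L\<^esub> x"
    and assoc: "\<forall>x\<in>S. \<forall>y\<in>S. \<forall>z\<in>S. x \<otimes>\<^bsub>?L\<^esub> y \<otimes>\<^bsub>?L\<^esub> z = x \<otimes>\<^bsub>?L\<^esub> (y \<otimes>\<^bsub>?L\<^esub> z)"
    and res: "\<forall>x\<in>S. \<forall>y\<in>S. \<forall>z\<in>S. x \<otimes>\<^bsub>?L\<^esub> z \<le> y \<longleftrightarrow> z \<le> x \<^bold>\<rightarrow>\<^bsub>?L\<^esub> y"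
    and pow: "\<forall>x\<in>S. x \<otimes>\<^bsub>?L\<^esub> x = x \<otimes>\<^bsub>?L\<^esub> x \<otimes>\<^bsub>?L\<^esub> x"
    and alt: "\<forall>x\<in>S. \<forall>y\<in>S. x = 5 \<or> x \<otimes>\<^bsub>?L\<^esub> min x y \<le> min x y \<otimes>\<^bsub>?L\<^esub> min x y"
    \<comment> \<open>Each carrier is finite, so every condition reduces to finitely many instances
      with numerals.\<close>
    using assms unfolding span_chain_def
    by (elim insertE emptyE; simp split del: if_split)+
  have S: "0 \<in> S" "5 \<in> S" "\<forall>x\<in>S. x \<le> 5"
    using assms by auto
  have simps: "carrier ?L = S" "\<one>\<^bsub>?L\<^esub> = 5" "\<^bold>0\<^bsub>?L\<^esub> = 0" "fmeet ?L = min" "fjoin ?L = max"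
    "5 \<otimes>\<^bsub>?L\<^esub> x = x" "x \<otimes>\<^bsub>?L\<^esub> 5 = x" for x
    by (simp_all add: span_chain_def)
  have flew: "flew_algebra ?L"
    by unfold_locales
      (use ops assoc res S in \<open>auto simp: simps fle_span_chain min_def max_def\<close>)
  interpret flew_algebra ?L by fact
  show ?thesis
    using pow alt S
    by (auto simp: GL2_generators_def flew totally_ordered_def fle_span_chain
        flew_algebra_pow[OF flew] simps min_def)
qed

text \<open>The operations are given by the same formulas for every carrier, so the inclusion
  preserves them.\<close>

lemma span_chain_embedding: "S \<subseteq> T \<Longrightarrow> flew_embedding (span_chain S) (span_chain T) id"
  by (auto simp: flew_embedding_def flew_hom_def span_chain_def)

text \<open>Residuate \<open>c \<otimes> b \<le> b \<otimes> b\<close>. If \<open>b\<close> is not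
  idempotent, the bound differs from \<open>\<one>\<close> and is thus the coatom.\<close>

lemma GL2_chains_coatom:
  assumes D: "D \<in> GL2_chains" and b: "b \<in> carrier D" and c: "c \<in> carrier D" "c \<noteq> \<one>\<^bsub>D\<^esub>"
    and "b \<^bold>\<le>\<^bsub>D\<^esub> c"
  shows "c \<^bold>\<le>\<^bsub>D\<^esub> b \<^bold>\<rightarrow>\<^bsub>D\<^esub> (b \<otimes>\<^bsub>D\<^esub> b)"
proof -
  interpret flew_algebra D
    using D by (auto simp: GL2_chains_def GL2_def generated_variety_def)
  show ?thesis
    using GL2_chains_mult_le[OF D c b \<open>b \<^bold>\<le>\<^bsub>D\<^esub> c\<close>] b c
    by (simp add: residuation[symmetric] m_comm)
qed

theorem theorem6p11:
  "\<not> amalgamation_property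
      (GL2_chains :: 'a::infinite flew set) (GL2_chains :: 'd flew set)"
proof
  assume ap: "amalgamation_property (GL2_chains :: 'a flew set) (GL2_chains :: 'd flew set)"
  obtain f :: "nat \<Rightarrow> 'a" where f: "inj f"
    using infinite_countable_subset[OF infinite_UNIV] by blast
  define A where "A = transport_flew f (span_chain {0,3,5})"
  define B where "B = transport_flew f (span_chain {0,1,2,3,5})"
  define C where "C = transport_flew f (span_chain {0,3,4,5})"
  \<comment> \<open>Up to the renaming \<open>f\<close>, this is the inclusion of
    \<open>{0,3,5}\<close>, and it serves for both \<open>B\<close> and \<open>C\<close>.\<close>
  define e where "e = f \<circ> id \<circ> inv_into UNIV f"
  have ABC: "A \<in> GL2_chains" "B \<in> GL2_chains" "C \<in> GL2_chains"
    unfolding A_def B_def C_def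
    using f
    by (auto intro!: subsetD[OF GL2_generators_subset_chains]
        transport_flew_generators span_chain_generators)
  have "flew_embedding A B e" "flew_embedding A C e"
    unfolding A_def B_def C_def e_def
    by (rule transport_flew_embedding[OF f span_chain_embedding], simp)+
  from ap[unfolded amalgamation_property_def, rule_format, OF ABC this]
  obtain D :: "'d flew" and h k where D: "D \<in> GL2_chains"
    and h: "flew_embedding B D h" and k: "flew_embedding C D k"
    and hk: "\<forall>x\<in>carrier A. h (e x) = k (e x)"
    by blast
  interpret flew_algebra D
    using D by (auto simp: GL2_chains_def GL2_def generated_variety_def)
  have B: "carrier B = f ` {0,1,2,3,5}" "f 2 \<^bold>\<and>\<^bsub>B\<^esub> f 3 = f 2" "f 2 \<otimes>\<^bsub>B\<^esub> f 2 = f 1"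
      "f 2 \<^bold>\<rightarrow>\<^bsub>B\<^esub> f 1 = f 3"
    using f by (simp_all add: B_def transport_flew_def Let_def span_chain_def)
  have C: "carrier C = f ` {0,3,4,5}" "f 3 \<^bold>\<and>\<^bsub>C\<^esub> f 4 = f 3" "\<one>\<^bsub>C\<^esub> = f 5"
    using f by (simp_all add: C_def transport_flew_def Let_def span_chain_def)
  have a: "h (f 3) = k (f 3)"
    using hk f by (simp add: e_def A_def transport_flew_def Let_def span_chain_def)
  have closed: "h (f 2) \<in> carrier D" "h (f 3) \<in> carrier D" "k (f 4) \<in> carrier D"
    using h k by (auto simp: flew_embedding_def flew_hom_def B C)
  have "h (f 2 \<^bold>\<and>\<^bsub>B\<^esub> f 3) = h (f 2) \<^bold>\<and>\<^bsub>D\<^esub> h (f 3)" "h (f 2 \<otimes>\<^bsub>B\<^esub> f 2) = h (f 2) \<otimes>\<^bsub>D\<^esub> h (f 2)"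
    "h (f 2 \<^bold>\<rightarrow>\<^bsub>B\<^esub> f 1) = h (f 2) \<^bold>\<rightarrow>\<^bsub>D\<^esub> h (f 1)"
    using h by (simp_all add: flew_embedding_def flew_hom_def B(1))
  \<comment> \<open>The equation \<open>a = b \<rightarrow> b \<otimes> b\<close> of
    \<open>B\<close> is carried to \<open>D\<close> by \<open>h\<close>.\<close>
  then have ba: "h (f 2) \<^bold>\<le>\<^bsub>D\<^esub> h (f 3)"
    and coatom: "h (f 2) \<^bold>\<rightarrow>\<^bsub>D\<^esub> (h (f 2) \<otimes>\<^bsub>D\<^esub> h (f 2)) = h (f 3)"
    by (simp_all add: B fle_def del: One_nat_def)
  have "k (f 3 \<^bold>\<and>\<^bsub>C\<^esub> f 4) = k (f 3) \<^bold>\<and>\<^bsub>D\<^esub> k (f 4)"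
    using k by (simp add: flew_embedding_def flew_hom_def C(1))
  then have ac: "h (f 3) \<^bold>\<le>\<^bsub>D\<^esub> k (f 4)"
    by (simp add: C a fle_def)
  have inj: "inj_on k (f ` {0,3,4,5})" and one: "k (f 5) = \<one>\<^bsub>D\<^esub>"
    using k by (auto simp: flew_embedding_def flew_hom_def C)
  have "k (f 4) \<noteq> \<one>\<^bsub>D\<^esub>"
    using inj_onD[OF inj, of "f 4" "f 5"] one by (auto simp: inj_eq[OF f])
  \<comment> \<open>The image of \<open>c\<close> is not \<open>\<one>\<close> and lies above that
    of \<open>b\<close>, so it lies below the coatom, the image of \<open>a\<close>. With
    \<open>ac\<close>, \<open>k\<close> would identify \<open>a\<close> and
    \<open>c\<close>.\<close>
  then have "k (f 4) \<^bold>\<le>\<^bsub>D\<^esub> h (f 3)"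
    using GL2_chains_coatom[OF D closed(1,3)] fle_trans[OF closed ba ac] coatom by simp
  then have "k (f 4) = k (f 3)"
    using ac a closed fle_antisym by metis
  then show False
    using inj_onD[OF inj, of "f 4" "f 3"] by (auto simp: inj_eq[OF f])
qed

end
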